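(* For every positive integer $n$, \[ B_{2n} = (-1)^{n-1} \Biggl[ a_n - b_n \sum_{k=0}^{\lfloor n/2 \rfloor}\frac{B_{2k}}{(2k)!\,(n-2k)!\,(n-k)} + (2n)! \sum_{k=0}^{\lfloor n/2 \rfloor}\frac{B_{2k}}{(2k)!\,(n-2k)!} \sum_{j=0}^{\lfloor n/2 \rfloor}\frac{B_{2j}}{(2j)!\,(n-2j)!}\cdot\frac{1}{2n-2k-2j+1} \Biggr], \] where $a_n = \frac{n}{2}\,\frac{(2n-2)!}{((n-1)!)^2}$ and $b_n = \frac{(2n)!}{2\,(n-1)!}$.
   Context: The Bernoulli numbers $B_m$ ($m \ge 0$ an integer) are defined by the generating function $\frac{x}{e^x-1} = \sum_{m=0}^\infty B_m \frac{x^m}{m!}$ for $|x|<2\pi$; in particular $B_0 = 1$, $B_1 = -\tfrac12$, $B_2 = \tfrac16$. *)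

theory Defs
  imports "HOL-Complex_Analysis.Complex_Analysis"
begin

text \<open>
  The quotient is one of formal power series over the field of reals. It is a genuine quotient although
  the denominator has no constant term, because both sides have subdegree 1. The lemma
  \<open>bernoulli_sums\<close> below shows that it is also the analytic generating function on the
  disc \<open>norm x < 2 * pi\<close>.
\<close>

definition bernoulli :: "nat \<Rightarrow> real" where
  "bernoulli m = fact m * fps_nth (fps_X / (fps_exp 1 - 1)) m"

definition coeff_a :: "nat \<Rightarrow> real" where
  "coeff_a n = real n / 2 * (fact (2 * n - 2) / (fact (n - 1))\<^sup>2)"

definition coeff_b :: "nat \<Rightarrow> real" where
  "coeff_b n = fact (2 * n) / (2 * fact (n - 1))"

lemma subdegree_fps_exp_minus_1:
  "subdegree (fps_exp (1 :: 'a :: field_char_0) - 1) = 1"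
  by (rule subdegreeI) auto

lemma fps_exp_minus_1_nonzero: "fps_exp (1 :: 'a :: field_char_0) - 1 \<noteq> 0"
  using subdegree_fps_exp_minus_1[where 'a = 'a] by force

lemma bernoulli_fps_mult:
  "Abs_fps (\<lambda>m. bernoulli m / fact m) * (fps_exp 1 - 1) = fps_X"
proof -
  have "Abs_fps (\<lambda>m. bernoulli m / fact m) = fps_X / (fps_exp 1 - 1)"
    by (simp add: fps_eq_iff bernoulli_def)
  moreover have "fps_exp (1::real) - 1 dvd fps_X"
    using fps_exp_minus_1_nonzero[where 'a = real]
    by (simp add: fps_dvd_iff subdegree_fps_exp_minus_1 del: subdegree_minus_commute)
  ultimately show ?thesis by simp
qed

lemma bernoulli_fps_complex:
  "Abs_fps (\<lambda>m. complex_of_real (bernoulli m / fact m)) = fps_X / (fps_exp 1 - 1)"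
proof -
  let ?F = "Abs_fps (\<lambda>m. complex_of_real (bernoulli m / fact m))"
  have "?F * (fps_exp 1 - 1) = fps_X"
  proof (rule fps_ext)
    fix n
    have *: "fps_nth (fps_exp 1 - 1) i = complex_of_real (fps_nth (fps_exp 1 - 1) i)" for i
      by simp
    have "fps_nth (?F * (fps_exp 1 - 1)) n =
          complex_of_real (fps_nth (Abs_fps (\<lambda>m. bernoulli m / fact m) * (fps_exp 1 - 1)) n)"
      unfolding fps_mult_nth of_real_sum of_real_mult * by simp
    also have "\<dots> = fps_nth fps_X n"
      unfolding bernoulli_fps_mult by simp
    finally show "fps_nth (?F * (fps_exp 1 - 1)) n = fps_nth fps_X n" .
  qed
  thus ?thesis
    by (metis fps_exp_minus_1_nonzero nonzero_mult_div_cancel_right)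
qed

lemma bernoulli_sums:
  fixes x :: complex
  assumes x: "norm x < 2 * pi"
  shows "(\<lambda>m. of_real (bernoulli m) * (x ^ m / fact m)) sums
           (if x = 0 then 1 else x / (exp x - 1))"
proof -
  let ?f = "\<lambda>x::complex. if x = 0 then 1 else x / (exp x - 1)"
  let ?F = "fps_X / (fps_exp 1 - 1) :: complex fps"
  have exp_1: "(\<lambda>x::complex. exp x - 1) has_fps_expansion fps_exp 1 - 1"
    by (intro fps_expansion_intros)
  have f: "?f has_fps_expansion ?F"
    by (rule has_fps_expansion_divide)
       (use fps_exp_minus_1_nonzero[where 'a = complex] exp_1 in
          \<open>auto simp: subdegree_fps_exp_minus_1 simp del: subdegree_minus_commute intro: fps_expansion_intros\<close>)
  have nz: "exp z \<noteq> 1" if "z \<in> ball 0 (2 * pi) - {0}" for z :: complex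
  proof
    assume "exp z = 1"
    then obtain k :: int where k: "Re z = 0" "Im z = of_int (2 * k) * pi"
      using exp_eq_1[of z] by auto
    hence "k \<noteq> 0" using that by (auto simp: complex_eq_iff)
    hence "\<bar>Im z\<bar> \<ge> 2 * pi" by (simp add: k abs_mult)
    thus False using abs_Im_le_cmod[of z] that by auto
  qed
  have "?f analytic_on {0}"
    using has_fps_expansion_imp_analytic_0[OF f] .
  hence "isCont ?f 0"
    by (simp add: analytic_at_imp_isCont)
  hence cont: "?f \<midarrow>0\<rightarrow> ?f 0"
    by (simp only: isCont_def)
  have "(\<lambda>x::complex. x / (exp x - 1)) holomorphic_on ball 0 (2 * pi) - {0}"
    using nz by (intro holomorphic_intros) auto
  hence holo': "?f holomorphic_on ball 0 (2 * pi) - {0}"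
    by (rule holomorphic_transform) auto
  have "?f holomorphic_on ball 0 (2 * pi)"
    by (rule no_isolated_singularity'[of "{0}"]) (use holo' cont in \<open>auto intro: Lim_at_imp_Lim_at_within\<close>)
  hence "(\<lambda>m. fps_nth ?F m * x ^ m) sums ?f x"
    using has_fps_expansion_imp_sums_complex[OF f, of "2 * pi" x] x by auto
  moreover have "fps_nth ?F m * x ^ m = of_real (bernoulli m) * (x ^ m / fact m)" for m
    unfolding bernoulli_fps_complex[symmetric] by simp
  ultimately show ?thesis by simp
qed

end

theory Submission
  imports Defs
begin

text \<open>
  Write \<open>b\<^sub>m(x) = B\<^sub>m(x) / m!\<close> for the scaled Bernoulli polynomials (\<open>sbp m\<close>). They satisfy
  \<open>b\<^sub>m\<^sub>+\<^sub>1' = b\<^sub>m\<close> and \<open>b\<^sub>m(0) = b\<^sub>m(1)\<close> for \<open>m \<noteq> 1\<close>, so that repeated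
  integration by parts turns the integral of \<open>b\<^sub>n\<^sup>2\<close> over the unit interval into
  \<open>(-1)\<^sup>n\<^sup>-\<^sup>1 B\<^sub>2\<^sub>n / (2n)!\<close>. On the other hand \<open>B\<^sub>m\<close> vanishes for odd \<open>m > 1\<close>, so \<open>b\<^sub>n\<close> is a sum of
  monomials \<open>x\<^sup>n\<^sup>-\<^sup>2\<^sup>k\<close> plus one term in \<open>x\<^sup>n\<^sup>-\<^sup>1\<close>; expanding the square and integrating
  termwise gives the three parts of the formula.
\<close>

section \<open>Small Bernoulli numbers and vanishing at odd indices\<close>

lemma bernoulli_0: "bernoulli 0 = 1"
proof -
  have "fps_nth (Abs_fps (\<lambda>m. bernoulli m / fact m) * (fps_exp 1 - 1)) 1 = 1"
    unfolding bernoulli_fps_mult by simp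
  thus ?thesis by (simp add: fps_mult_nth)
qed

text \<open>With F(x) = x/(e^x - 1) one has F(-x) = x e^x/(e^x - 1) = F(x) + x; comparing
  coefficients gives the claim. The case \<open>m = 1\<close> yields the value of
  \<open>bernoulli 1\<close>, the other odd \<open>m\<close> yield zero.\<close>

lemma bernoulli_reflect:
  "(-1) ^ m * bernoulli m = bernoulli m + (if m = 1 then 1 else 0)"
proof -
  define F where "F = Abs_fps (\<lambda>m. bernoulli m / fact m)"
  define G where "G = F oo (- fps_X)"
  have F: "F * (fps_exp 1 - 1) = fps_X"
    unfolding F_def by (rule bernoulli_fps_mult)
  have "G * (fps_exp (-1) - 1) = (F * (fps_exp 1 - 1)) oo (- fps_X)"
    unfolding G_def
    by (simp add: fps_compose_mult_distrib fps_compose_sub_distrib fps_exp_compose_linear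
        flip: fps_const_neg)
  hence G: "G * (fps_exp (-1) - 1) = - fps_X"
    unfolding F by simp
  have "fps_exp (-1 :: real) * fps_exp 1 = 1"
    by (simp flip: fps_exp_add_mult)
  \<comment> \<open>Multiplying by e^X brings back the denominator of \<open>F\<close>, since
    (e^(-X) - 1) e^X = -(e^X - 1); that factor is cancelled at the end.\<close>
  hence "G * (fps_exp 1 - 1) = - (G * (fps_exp (-1) - 1)) * fps_exp 1"
    by (simp add: algebra_simps)
  also have "\<dots> = fps_X * fps_exp 1"
    unfolding G by simp
  also have "\<dots> = (F + fps_X) * (fps_exp 1 - 1)"
    using F by (simp add: algebra_simps)
  finally have "G = F + fps_X"
    using fps_exp_minus_1_nonzero[where 'a = real] by simp
  hence "fps_nth G m = fps_nth F m + fps_nth fps_X m"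
    by simp
  moreover have "fps_nth G m = (-1) ^ m * fps_nth F m"
    unfolding G_def by (simp add: fps_compose_uminus')
  ultimately show ?thesis
    by (cases "m = 1") (simp_all add: F_def field_simps)
qed

lemma bernoulli_1: "bernoulli 1 = -1/2"
  using bernoulli_reflect[of 1] by simp

lemma bernoulli_odd_eq_0:
  assumes "odd m" "m \<noteq> 1"
  shows "bernoulli m = 0"
  using bernoulli_reflect[of m] assms by simp

section \<open>Scaled Bernoulli polynomials\<close>

definition sbp :: "nat \<Rightarrow> real \<Rightarrow> real" where
  "sbp m x = (\<Sum>i\<le>m. bernoulli i / fact i * (x ^ (m - i) / fact (m - i)))"

lemma sbp_0: "sbp 0 x = 1"
  by (simp add: sbp_def bernoulli_0)

lemma sbp_1: "sbp 1 x = x - 1/2"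
  using bernoulli_1 by (simp add: sbp_def bernoulli_0)

lemma sbp_at_0: "sbp m 0 = bernoulli m / fact m"
proof -
  have "sbp m 0 = (\<Sum>i\<in>{m}. bernoulli i / fact i * (0 ^ (m - i) / fact (m - i)))"
    unfolding sbp_def by (rule sum.mono_neutral_right) auto
  thus ?thesis by simp
qed

text \<open>At 1 the generating function is F e^X = F + X, with F that of the values at 0. The
  summand X is what excludes \<open>m = 1\<close>.\<close>

lemma sbp_at_1:
  assumes "m \<noteq> 1"
  shows "sbp m 1 = bernoulli m / fact m"
proof -
  let ?F = "Abs_fps (\<lambda>m. bernoulli m / fact m)"
  have "sbp m 1 = fps_nth (?F * fps_exp 1) m"
    by (simp add: sbp_def fps_mult_nth atMost_atLeast0)
  also have "?F * fps_exp 1 = fps_X + ?F"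
    using bernoulli_fps_mult by (simp add: algebra_simps)
  finally show ?thesis using assms by simp
qed

lemma has_real_derivative_sbp:
  "(sbp (Suc m) has_real_derivative sbp m x) (at x within S)"
proof -
  have "((\<lambda>x. bernoulli i / fact i * (x ^ (Suc m - i) / fact (Suc m - i))) has_real_derivative
          bernoulli i / fact i * (x ^ (m - i) / fact (m - i))) (at x within S)"
    if "i \<le> m" for i
  proof -
    have "((\<lambda>x. x ^ Suc d / fact (Suc d)) has_real_derivative x ^ d / fact d) (at x within S)"
      for d
      by (rule DERIV_cong[OF DERIV_cdivide[OF DERIV_pow]]) simp
    from DERIV_cmult[OF this] show ?thesis
      using that by (simp only: Suc_diff_le)
  qed
  \<comment> \<open>The summand with index \<open>Suc m\<close> is constant in \<open>x\<close> and
    is split off; the others each contain a positive power of \<open>x\<close>.\<close>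
  moreover have "sbp (Suc m) = (\<lambda>x. (\<Sum>i\<le>m. bernoulli i / fact i * (x ^ (Suc m - i) / fact (Suc m - i)))
                    + bernoulli (Suc m) / fact (Suc m))"
    by (rule ext) (simp add: sbp_def)
  ultimately show ?thesis
    unfolding sbp_def[of m]
    by (auto intro!: DERIV_cong[OF DERIV_add[OF DERIV_sum DERIV_const]] simp del: fact_Suc)
qed

lemma continuous_on_sbp: "continuous_on S (sbp m)"
  unfolding sbp_def by (intro continuous_intros) auto

section \<open>Integrals of products over the unit interval\<close>

lemma has_integral_sbp_mult_parts:
  "((\<lambda>x. sbp (Suc m) x * sbp k x + sbp m x * sbp (Suc k) x) has_integral
     (sbp (Suc m) 1 * sbp (Suc k) 1 - sbp (Suc m) 0 * sbp (Suc k) 0)) {0..1}"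
  by (rule fundamental_theorem_of_calculus)
     (auto simp flip: has_real_derivative_iff_has_vector_derivative
           intro!: derivative_eq_intros has_real_derivative_sbp)

lemma integrable_sbp_mult: "(\<lambda>x. sbp m x * sbp k x) integrable_on {0..1}"
  by (intro integrable_continuous_interval continuous_intros continuous_on_sbp)

lemma integral_sbp_mult_shift:
  "integral {0..1} (\<lambda>x. sbp (Suc m) x * sbp k x) + integral {0..1} (\<lambda>x. sbp m x * sbp (Suc k) x) =
     sbp (Suc m) 1 * sbp (Suc k) 1 - sbp (Suc m) 0 * sbp (Suc k) 0"
  using integral_unique[OF has_integral_sbp_mult_parts[of m k]]
  by (simp add: integral_add integrable_sbp_mult)

text \<open>Each integration by parts moves one index from the left factor to the right and costs a
  sign. The boundary terms cancel as long as neither index is 1; \<open>k \<ge> 1\<close> keeps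
  \<open>Suc k\<close> away from 1.\<close>

lemma integral_sbp_mult:
  assumes "k \<ge> 1"
  shows "integral {0..1} (\<lambda>x. sbp (Suc m) x * sbp k x) =
           (-1) ^ m * bernoulli (Suc m + k) / fact (Suc m + k)"
  using assms
proof (induction m arbitrary: k)
  case 0
  have "integral {0..1} (sbp (Suc k)) = sbp (Suc (Suc k)) 1 - sbp (Suc (Suc k)) 0"
    by (intro integral_unique fundamental_theorem_of_calculus)
       (auto simp flip: has_real_derivative_iff_has_vector_derivative
             intro!: has_real_derivative_sbp)
  hence "integral {0..1} (\<lambda>x. sbp 0 x * sbp (Suc k) x) = 0"
    by (simp add: sbp_0 sbp_at_0 sbp_at_1)
  \<comment> \<open>Only here does a boundary term survive: \<open>sbp 1\<close> is 1/2 at 1 and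
    -1/2 at 0, while \<open>sbp (Suc k)\<close> agrees at both ends.\<close>
  moreover have "sbp (Suc 0) 1 * sbp (Suc k) 1 - sbp (Suc 0) 0 * sbp (Suc k) 0 =
                   bernoulli (Suc k) / fact (Suc k)"
    using 0 by (simp add: sbp_1[unfolded One_nat_def] sbp_at_1 sbp_at_0[of "Suc k"] del: fact_Suc)
  ultimately show ?case
    using integral_sbp_mult_shift[of 0 k] by simp
next
  case (Suc m)
  have "integral {0..1} (\<lambda>x. sbp (Suc (Suc m)) x * sbp k x) =
          - integral {0..1} (\<lambda>x. sbp (Suc m) x * sbp (Suc k) x)"
    using integral_sbp_mult_shift[of "Suc m" k] Suc.prems
    by (simp add: sbp_at_0 sbp_at_1 del: fact_Suc)
  thus ?case
    using Suc.IH[of "Suc k"] by (simp del: fact_Suc)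
qed

section \<open>Expansion of the square and termwise integration\<close>

lemma sbp_even_expansion:
  assumes "n \<ge> 1"
  shows "sbp n x = (\<Sum>k = 0..n div 2. bernoulli (2 * k) / (fact (2 * k) * fact (n - 2 * k)) * x ^ (n - 2 * k))
                     - x ^ (n - 1) / (2 * fact (n - 1))"
proof -
  let ?f = "\<lambda>i. bernoulli i / fact i * (x ^ (n - i) / fact (n - i))"
  let ?E = "(\<lambda>k. 2 * k) ` {0..n div 2}"
  \<comment> \<open>Besides the even indices only 1 can contribute, with coefficient -1/2; it lies
    in the range because \<open>n \<ge> 1\<close>.\<close>
  have "sbp n x = sum ?f (insert 1 ?E)"
    unfolding sbp_def
  proof (rule sum.mono_neutral_right)
    show "\<forall>i\<in>{..n} - insert 1 ?E. ?f i = 0"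
    proof
      fix i assume i: "i \<in> {..n} - insert 1 ?E"
      have "odd i"
      proof
        assume "even i"
        then obtain k where "i = 2 * k" ..
        with i show False by auto
      qed
      with i show "?f i = 0" by (simp add: bernoulli_odd_eq_0)
    qed
  qed (use assms in auto)
  also have "\<dots> = ?f 1 + sum ?f ?E"
    by (rule sum.insert) (simp, force)
  also have "sum ?f ?E = (\<Sum>k = 0..n div 2. ?f (2 * k))"
    by (simp add: sum.reindex inj_on_def)
  finally show ?thesis
    by (simp add: bernoulli_1[unfolded One_nat_def] mult_ac)
qed

lemma has_integral_power_unit:
  "((\<lambda>x::real. x ^ m) has_integral 1 / (real m + 1)) {0..1}"
proof -
  have "((\<lambda>x::real. x ^ m) has_integral 1 ^ Suc m / (real m + 1) - 0 ^ Suc m / (real m + 1)) {0..1}"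
    by (rule fundamental_theorem_of_calculus)
       (auto simp flip: has_real_derivative_iff_has_vector_derivative
             simp: add.commute[of 1] simp del: power_Suc
             intro!: DERIV_cong[OF DERIV_cdivide[OF DERIV_pow]])
  thus ?thesis by simp
qed

lemma integral_sbp_square:
  assumes n: "n \<ge> 1"
  defines "c \<equiv> \<lambda>k. bernoulli (2 * k) / (fact (2 * k) * fact (n - 2 * k))"
  shows "integral {0..1} (\<lambda>x. sbp n x * sbp n x) =
           1 / (4 * (fact (n - 1))\<^sup>2 * (2 * real n - 1))
           - (\<Sum>k = 0..n div 2. c k / (2 * fact (n - 1) * (real n - real k)))
           + (\<Sum>k = 0..n div 2. c k * (\<Sum>j = 0..n div 2. c j * (1 / (2 * real n - 2 * real k - 2 * real j + 1))))"
proof (rule integral_unique)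
  let ?K = "{0..n div 2}" and ?d = "1 / (2 * fact (n - 1)) :: real"
  have eq: "sbp n x * sbp n x =
          ?d\<^sup>2 * x ^ (2 * n - 2) - (\<Sum>k\<in>?K. 2 * ?d * c k * x ^ (2 * n - 2 * k - 1))
          + (\<Sum>k\<in>?K. \<Sum>j\<in>?K. c k * c j * x ^ (2 * n - 2 * k - 2 * j))" for x
  proof -
    define E where "E = (\<Sum>k\<in>?K. c k * x ^ (n - 2 * k))"
    have "sbp n x = E - ?d * x ^ (n - 1)"
      unfolding E_def c_def using sbp_even_expansion[OF n, of x] by simp
    \<comment> \<open>Stated for arbitrary \<open>d\<close> and \<open>y\<close>, so that the
      fraction and the power are not rewritten during the expansion.\<close>
    moreover have "(E - d * y) * (E - d * y) = d\<^sup>2 * (y * y) - 2 * d * y * E + E * E" for d y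
      by (simp add: power2_eq_square algebra_simps)
    ultimately have "sbp n x * sbp n x =
        ?d\<^sup>2 * (x ^ (n - 1) * x ^ (n - 1)) - 2 * ?d * x ^ (n - 1) * E + E * E"
      by (simp only:)
    also have "x ^ (n - 1) * x ^ (n - 1) = x ^ (2 * n - 2)"
      by (simp flip: power_add mult_2 add: right_diff_distrib')
    also have "2 * ?d * x ^ (n - 1) * E = (\<Sum>k\<in>?K. 2 * ?d * c k * x ^ (2 * n - 2 * k - 1))"
      unfolding E_def sum_distrib_left
    proof (rule sum.cong[OF refl])
      fix k assume "k \<in> ?K"
      hence "2 * n - 2 * k - 1 = (n - 1) + (n - 2 * k)" using n by auto
      thus "2 * ?d * x ^ (n - 1) * (c k * x ^ (n - 2 * k)) = 2 * ?d * c k * x ^ (2 * n - 2 * k - 1)"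
        by (simp only: power_add mult_ac)
    qed
    also have "E * E = (\<Sum>k\<in>?K. \<Sum>j\<in>?K. c k * c j * x ^ (2 * n - 2 * k - 2 * j))"
      unfolding E_def sum_product
    proof (intro sum.cong[OF refl])
      fix k j assume "k \<in> ?K" "j \<in> ?K"
      hence "2 * n - 2 * k - 2 * j = (n - 2 * k) + (n - 2 * j)" by auto
      thus "c k * x ^ (n - 2 * k) * (c j * x ^ (n - 2 * j)) = c k * c j * x ^ (2 * n - 2 * k - 2 * j)"
        by (simp only: power_add mult_ac)
    qed
    finally show ?thesis .
  qed
  have "((\<lambda>x. sbp n x * sbp n x) has_integral
          ?d\<^sup>2 * (1 / (real (2 * n - 2) + 1))
          - (\<Sum>k\<in>?K. 2 * ?d * c k * (1 / (real (2 * n - 2 * k - 1) + 1)))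
          + (\<Sum>k\<in>?K. \<Sum>j\<in>?K. c k * c j * (1 / (real (2 * n - 2 * k - 2 * j) + 1)))) {0..1}"
    unfolding eq
    by (intro has_integral_add has_integral_diff has_integral_sum has_integral_mult_right
        has_integral_power_unit) auto
  also have "?d\<^sup>2 * (1 / (real (2 * n - 2) + 1)) = 1 / (4 * (fact (n - 1))\<^sup>2 * (2 * real n - 1))"
    using n by (simp add: of_nat_diff power2_eq_square)
  also have "(\<Sum>k\<in>?K. 2 * ?d * c k * (1 / (real (2 * n - 2 * k - 1) + 1))) =
               (\<Sum>k\<in>?K. c k / (2 * fact (n - 1) * (real n - real k)))"
  proof (rule sum.cong[OF refl])
    fix k assume "k \<in> ?K"
    hence "2 * k \<le> n" by auto
    \<comment> \<open>Strictness makes the truncated subtraction of 1 in the exponent exact.\<close>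
    hence "k < n" using n by linarith
    hence "real (2 * n - 2 * k - 1) + 1 = 2 * (real n - real k)"
      by (simp add: of_nat_diff)
    thus "2 * ?d * c k * (1 / (real (2 * n - 2 * k - 1) + 1)) =
            c k / (2 * fact (n - 1) * (real n - real k))"
      by simp
  qed
  also have "(\<Sum>k\<in>?K. \<Sum>j\<in>?K. c k * c j * (1 / (real (2 * n - 2 * k - 2 * j) + 1))) =
      (\<Sum>k\<in>?K. c k * (\<Sum>j\<in>?K. c j * (1 / (2 * real n - 2 * real k - 2 * real j + 1))))"
    unfolding sum_distrib_left
  proof (intro sum.cong[OF refl])
    fix k j assume "k \<in> ?K" "j \<in> ?K"
    hence "2 * k \<le> n" "2 * j \<le> n" by auto
    hence "real (2 * n - 2 * k - 2 * j) = 2 * real n - 2 * real k - 2 * real j"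
      by (simp add: of_nat_diff)
    thus "c k * c j * (1 / (real (2 * n - 2 * k - 2 * j) + 1)) =
            c k * (c j * (1 / (2 * real n - 2 * real k - 2 * real j + 1)))"
      by simp
  qed
  finally show "((\<lambda>x. sbp n x * sbp n x) has_integral
           1 / (4 * (fact (n - 1))\<^sup>2 * (2 * real n - 1))
           - (\<Sum>k\<in>?K. c k / (2 * fact (n - 1) * (real n - real k)))
           + (\<Sum>k\<in>?K. c k * (\<Sum>j\<in>?K. c j * (1 / (2 * real n - 2 * real k - 2 * real j + 1))))) {0..1}" .
qed

theorem theorem1:
  fixes n :: nat
  assumes "n \<ge> 1"
  shows "bernoulli (2 * n) = (- 1) ^ (n - 1) *
    (coeff_a n
     - coeff_b n *
         (\<Sum>k = 0..n div 2.
            bernoulli (2 * k) / (fact (2 * k) * fact (n - 2 * k) * (real n - real k)))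
     + fact (2 * n) *
         (\<Sum>k = 0..n div 2.
            bernoulli (2 * k) / (fact (2 * k) * fact (n - 2 * k)) *
            (\<Sum>j = 0..n div 2.
               bernoulli (2 * j) / (fact (2 * j) * fact (n - 2 * j)) *
               (1 / (2 * real n - 2 * real k - 2 * real j + 1)))))"
proof -
  define c where "c = (\<lambda>k. bernoulli (2 * k) / (fact (2 * k) * fact (n - 2 * k)))"
  let ?K = "{0..n div 2}"
  define S where "S = (\<Sum>k\<in>?K. c k / (real n - real k))"
  define T where "T = (\<Sum>k\<in>?K. c k * (\<Sum>j\<in>?K. c j * (1 / (2 * real n - 2 * real k - 2 * real j + 1))))"
  obtain m where m: "n = Suc m" using assms by (cases n) auto
  \<comment> \<open>Both factors have index \<open>n = Suc m\<close>, so the sign is that of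
    \<open>n - 1\<close> shifts.\<close>
  have "(-1) ^ m * bernoulli (2 * n) / fact (2 * n) =
          integral {0..1} (\<lambda>x. sbp n x * sbp n x)"
    using integral_sbp_mult[of n m] assms by (simp add: m mult_2 del: fact_Suc)
  also have "\<dots> = 1 / (4 * (fact m)\<^sup>2 * (2 * real n - 1)) - S / (2 * fact m) + T"
  proof -
    have "S / (2 * fact m) = (\<Sum>k\<in>?K. c k / (2 * fact m * (real n - real k)))"
      unfolding S_def by (simp add: sum_divide_distrib mult_ac)
    thus ?thesis
      using integral_sbp_square[OF assms] unfolding T_def c_def by (simp add: m)
  qed
  finally have main: "(-1) ^ m * bernoulli (2 * n) =
      fact (2 * n) * (1 / (4 * (fact m)\<^sup>2 * (2 * real n - 1)) - S / (2 * fact m) + T)"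
    by (simp add: divide_eq_eq mult.commute)
  have "bernoulli (2 * n) = (-1) ^ m * ((-1) ^ m * bernoulli (2 * n))"
    by (simp flip: mult.assoc power_mult_distrib)
  also have "\<dots> = (-1) ^ m *
      (fact (2 * n) * (1 / (4 * (fact m)\<^sup>2 * (2 * real n - 1))) - coeff_b n * S + fact (2 * n) * T)"
    unfolding main coeff_b_def by (simp add: m algebra_simps del: fact_Suc)
  also have "fact (2 * n) * (1 / (4 * (fact m)\<^sup>2 * (2 * real n - 1))) = coeff_a n"
  proof -
    \<comment> \<open>From (2n)! = 2n (2n-1) (2n-2)!, the integral of x^(2n-2) cancels the factor
      2n-1, and 2n/4 is the n/2 in \<open>coeff_a\<close>. Naming the factor \<open>N\<close> lets
      it cancel as a single nonzero term.\<close>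
    define N where "N = 2 * real n - 1"
    have "fact (2 * n) = 2 * real n * N * fact (2 * n - 2)"
      by (simp add: m N_def algebra_simps)
    moreover have "N \<noteq> 0" by (simp add: m N_def)
    moreover have "n - 1 = m" by (simp add: m)
    ultimately show ?thesis
      unfolding coeff_a_def N_def[symmetric] by simp
  qed
  finally show ?thesis
    unfolding S_def T_def c_def by (simp add: m)
qed

end
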